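(* Let $m=4$, $r=1$, $d=3$, and let $$\bm W=\begin{bmatrix}1\\1\\-1\\-1\end{bmatrix},\quad \bm H=\begin{bmatrix}1&2&1\\1&-2&3\\2&-2&2\\-1&2&3\end{bmatrix},\quad \bm b=\begin{bmatrix}0\\0\\0\\0\end{bmatrix}.$$ Let $\Xi\subset\mathbb{R}^3$ be the polyhedron $$\Xi=\mathrm{conv}\{\bm 0,\bm p_1,\ldots,\bm p_7\},\quad \bm p_j=[\cos\theta_j,\ \sin\theta_j,\ 1]^\top,\quad \theta_j=\frac{2\pi(j-1)}{7},\quad j=1,\ldots,7.$$ Then the recourse system $\bm W y+\bm H\bm\xi\ge\bm b$ is globally feasible on $\Xi$, but it is not locally linear feasible at the vertex $\bm\zeta_0=\bm 0$.
   Context: Vector inequalities are componentwise. For $\bm W\in\mathbb{R}^{m\times r}$, $\bm H\in\mathbb{R}^{m\times d}$, $\bm b\in\mathbb{R}^m$, the recourse system is $\bm W\bm y+\bm H\bm\xi\ge\bm b$, with unknown $\bm y\in\mathbb{R}^r$ and parameter $\bm\xi\in\Xi\subset\mathbb{R}^d$. Globally feasible on $\Xi$: there exists a function $\bm y:\mathbb{R}^d\to\mathbb{R}^r$ such that $\bm W\bm y(\bm\xi)+\bm H\bm\xi\ge\bm b$ for every $\bm\xi\in\Xi$. Locally linear feasible at a vertex $\bm\zeta_0$ of $\Xi$: there exist $\epsilon>0$ and an affine function $\bm y(\bm\xi)=\bm y_0+\bm Y\bm\xi$ with $\bm y_0\in\mathbb{R}^r$, $\bm Y\in\mathbb{R}^{r\times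 d}$, such that $\bm W\bm y(\bm\xi)+\bm H\bm\xi\ge\bm b$ for all $\bm\xi\in\Xi\cap B(\bm\zeta_0,\epsilon)$, where $B(\bm\zeta_0,\epsilon)$ is the ball of radius $\epsilon$ centered at $\bm\zeta_0$. *)

theory Defs
  imports "HOL-Analysis.Analysis"
begin

text \<open>
  The order on \<^typ>\<open>real ^ 'm\<close> is the componentwise one. A scenario set \<open>X\<close> plays the role of
  \<open>\<Xi>\<close>.
\<close>

definition globally_feasible ::
  "real ^ 'r ^ 'm \<Rightarrow> real ^ 'd ^ 'm \<Rightarrow> real ^ 'm \<Rightarrow> (real ^ 'd) set \<Rightarrow> bool"
  where "globally_feasible W H b X \<longleftrightarrow>
    (\<exists>y :: real ^ 'd \<Rightarrow> real ^ 'r. \<forall>\<xi>\<in>X. W *v y \<xi> + H *v \<xi> \<ge> b)"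

text \<open>
  The point \<open>z\<close> is meant to be a vertex of \<open>X\<close>. This is not part of the definition, so that a
  negated instance does not hold merely because \<open>z\<close> fails to be a vertex.
\<close>

definition locally_linear_feasible ::
  "real ^ 'r ^ 'm \<Rightarrow> real ^ 'd ^ 'm \<Rightarrow> real ^ 'm \<Rightarrow> (real ^ 'd) set \<Rightarrow> real ^ 'd \<Rightarrow> bool"
  where "locally_linear_feasible W H b X z \<longleftrightarrow>
    (\<exists>\<epsilon>>0. \<exists>(y\<^sub>0 :: real ^ 'r) (Y :: real ^ 'd ^ 'r).
      \<forall>\<xi>\<in>X \<inter> ball z \<epsilon>. W *v (y\<^sub>0 + Y *v \<xi>) + H *v \<xi> \<ge> b)"

definition W_ex :: "real ^ 1 ^ 4"
  where "W_ex = vector [vector [1], vector [1], vector [-1], vector [-1]]"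

definition H_ex :: "real ^ 3 ^ 4"
  where "H_ex = vector [vector [1, 2, 1], vector [1, -2, 3], vector [2, -2, 2], vector [-1, 2, 3]]"

definition b_ex :: "real ^ 4"
  where "b_ex = vector [0, 0, 0, 0]"

definition theta_ex :: "nat \<Rightarrow> real"
  where "theta_ex j = 2 * pi * (real j - 1) / 7"

definition p_ex :: "nat \<Rightarrow> real ^ 3"
  where "p_ex j = vector [cos (theta_ex j), sin (theta_ex j), 1]"

definition Xi_ex :: "(real ^ 3) set"
  where "Xi_ex = convex hull (insert 0 (p_ex ` {1..7}))"

text \<open>The library evaluates \<^const>\<open>vector\<close> only up to dimension 3.\<close>

lemma vector_4_nth [simp]:
  "(vector [a, b, c, d] :: 'a::zero ^ 4) $ 1 = a"
  "(vector [a, b, c, d] :: 'a::zero ^ 4) $ 2 = b"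
  "(vector [a, b, c, d] :: 'a::zero ^ 4) $ 3 = c"
  "(vector [a, b, c, d] :: 'a::zero ^ 4) $ 4 = d"
  unfolding vector_def by simp_all

end

theory Submission
  imports Defs
begin

text \<open>
  The four rows say \<open>-l\<^sub>1, -l\<^sub>2 \<le> y \<le> u\<^sub>1, u\<^sub>2\<close> for linear forms \<open>l\<^sub>i, u\<^sub>k\<close> in \<open>\<xi>\<close>, so a recourse exists
  at \<open>\<xi>\<close> exactly when every \<open>u\<^sub>k + l\<^sub>i\<close> is nonnegative there. The set \<open>\<Xi>\<close> lies in the circular cone
  \<open>\<xi>\<^sub>1\<^sup>2 + \<xi>\<^sub>2\<^sup>2 \<le> \<xi>\<^sub>3\<^sup>2\<close>, \<open>\<xi>\<^sub>3 \<ge> 0\<close>, and all four forms \<open>u\<^sub>k + l\<^sub>i\<close> belong to its dual, the cone of all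
  \<open>(u, v, w)\<close> with \<open>u\<^sup>2 + v\<^sup>2 \<le> w\<^sup>2\<close>, \<open>w \<ge> 0\<close> (lemma \<open>Xi_ex_dual_cone\<close>). The same lemma shows that \<open>0\<close>
  is extreme, since the cone is pointed.

  An affine recourse near \<open>0\<close> must vanish at \<open>0\<close>, because there \<open>y \<ge> 0\<close> and \<open>-y \<ge> 0\<close>; by
  homogeneity its linear part is then a recourse on all of \<open>\<Xi>\<close>
  (lemma \<open>locally_linear_feasible_homogeneous\<close>). A single linear function \<open>Y\<close> of this kind is
  refuted by the isosceles trapezoid \<open>p\<^sub>3, p\<^sub>4, p\<^sub>5, p\<^sub>6\<close> of the heptagon. Its parallel sides satisfy
  \<open>sin (6\<pi>/7) (p\<^sub>3 - p\<^sub>6) = sin (4\<pi>/7) (p\<^sub>4 - p\<^sub>5)\<close>, so \<open>Y\<close> satisfies the same identity. Bounding \<open>Y\<close>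
  below by \<open>-l\<^sub>2\<close> at \<open>p\<^sub>3\<close> and by \<open>-l\<^sub>1\<close> at \<open>p\<^sub>5\<close>, and above by \<open>u\<^sub>1\<close> at \<open>p\<^sub>4\<close> and by \<open>u\<^sub>2\<close> at \<open>p\<^sub>6\<close>, forces
  an inequality between sines and cosines that lemma \<open>heptagon_certificate_negative\<close> contradicts.
\<close>

lemma system_ex_iff:
  "W_ex *v y + H_ex *v x \<ge> b_ex \<longleftrightarrow>
     0 \<le> y $ 1 + (x $ 1 + 2 * x $ 2 + x $ 3) \<and>
     0 \<le> y $ 1 + (x $ 1 - 2 * x $ 2 + 3 * x $ 3) \<and>
     y $ 1 \<le> 2 * x $ 1 - 2 * x $ 2 + 2 * x $ 3 \<and>
     y $ 1 \<le> - x $ 1 + 2 * x $ 2 + 3 * x $ 3"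
  by (simp add: less_eq_vec_def forall_4 matrix_vector_mult_def sum_3 W_ex_def H_ex_def b_ex_def
      algebra_simps)

text \<open>
  Each generator \<open>p\<^sub>j\<close> has the form \<open>(c, s, 1)\<close> with \<open>c\<^sup>2 + s\<^sup>2 = 1\<close>, where Cauchy-Schwarz gives
  \<open>\<bar>u c + v s\<bar> \<le> w\<close>; the halfspace therefore contains all generators, hence their convex hull.
\<close>

lemma Xi_ex_dual_cone:
  assumes x: "x \<in> Xi_ex" and w: "u\<^sup>2 + v\<^sup>2 \<le> w\<^sup>2" "0 \<le> w"
  shows "0 \<le> u * x $ 1 + v * x $ 2 + w * x $ 3"
proof -
  define a :: "real ^ 3" where "a = vector [u, v, w]"
  have inner_a: "a \<bullet> z = u * z $ 1 + v * z $ 2 + w * z $ 3" for z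
    by (simp add: a_def inner_vec_def sum_3)
  have "0 \<le> a \<bullet> p_ex j" for j
  proof -
    define c s where "c = cos (theta_ex j)" and "s = sin (theta_ex j)"
    have "c\<^sup>2 + s\<^sup>2 = 1"
      by (simp add: c_def s_def)
    then have "(u * c + v * s)\<^sup>2 + (u * s - v * c)\<^sup>2 = u\<^sup>2 + v\<^sup>2"
      by algebra
    then have "(u * c + v * s)\<^sup>2 \<le> w\<^sup>2"
      using w(1) zero_le_power2[of "u * s - v * c"] by linarith
    then have "\<bar>u * c + v * s\<bar> \<le> w"
      using w(2) abs_le_square_iff[of "u * c + v * s" w] by simp
    then show ?thesis
      by (simp add: inner_a p_ex_def c_def s_def)
  qed
  then have "insert 0 (p_ex ` {1..7}) \<subseteq> {z. a \<bullet> z \<ge> 0}"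
    by auto
  then have "Xi_ex \<subseteq> {z. a \<bullet> z \<ge> 0}"
    unfolding Xi_ex_def by (rule hull_minimal) (rule convex_halfspace_ge)
  then show ?thesis
    using x inner_a by auto
qed

lemma convex_Xi_ex: "convex Xi_ex"
  by (simp add: Xi_ex_def)

lemma zero_in_Xi_ex: "0 \<in> Xi_ex"
  by (simp add: Xi_ex_def hull_inc)

lemma p_ex_in_Xi_ex: "j \<in> {1..7} \<Longrightarrow> p_ex j \<in> Xi_ex"
  by (simp add: Xi_ex_def hull_inc)

lemma Xi_ex_third_zero:
  assumes "x \<in> Xi_ex" "x $ 3 = 0"
  shows "x = 0"
  using Xi_ex_dual_cone[OF assms(1), of 1 0 1] Xi_ex_dual_cone[OF assms(1), of "-1" 0 1]
    Xi_ex_dual_cone[OF assms(1), of 0 1 1] Xi_ex_dual_cone[OF assms(1), of 0 "-1" 1] assms(2)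
  by (simp add: vec_eq_iff forall_3)

lemma zero_extreme_point_of_Xi_ex: "0 extreme_point_of Xi_ex"
  unfolding extreme_point_of_def
proof (intro conjI ballI notI)
  show "0 \<in> Xi_ex"
    by (rule zero_in_Xi_ex)
next
  fix a b
  assume ab: "a \<in> Xi_ex" "b \<in> Xi_ex" "0 \<in> open_segment a b"
  then obtain t where t: "a \<noteq> b" "0 < t" "t < 1" and "0 = (1 - t) *\<^sub>R a + t *\<^sub>R b"
    by (auto simp: in_segment)
  then have "(1 - t) * a $ 3 + t * b $ 3 = 0"
    by (metis vector_add_component vector_scaleR_component zero_index real_scaleR_def)
  moreover have nonneg: "0 \<le> a $ 3" "0 \<le> b $ 3"
    using Xi_ex_dual_cone[OF ab(1), of 0 0 1] Xi_ex_dual_cone[OF ab(2), of 0 0 1] by simp_all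
  ultimately have "(1 - t) * a $ 3 = 0 \<and> t * b $ 3 = 0"
    using t by (subst (asm) add_nonneg_eq_0_iff) auto
  then have "a $ 3 = 0" "b $ 3 = 0"
    using t by auto
  then have "a = b"
    using Xi_ex_third_zero ab by metis
  then show False
    using t by simp
qed

lemma globally_feasible_ex: "globally_feasible W_ex H_ex b_ex Xi_ex"
proof -
  define y :: "real ^ 3 \<Rightarrow> real ^ 1" where
    "y x = vec (max (- (x $ 1 + 2 * x $ 2 + x $ 3)) (- (x $ 1 - 2 * x $ 2 + 3 * x $ 3)))" for x
  have "W_ex *v y x + H_ex *v x \<ge> b_ex" if x: "x \<in> Xi_ex" for x
  proof -
    \<comment> \<open>The coefficient vectors of the four sums \<open>u\<^sub>k + l\<^sub>i\<close>.\<close>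
    note Xi_ex_dual_cone[OF x, of 3 0 3] Xi_ex_dual_cone[OF x, of 3 "-4" 5]
      Xi_ex_dual_cone[OF x, of 0 4 4] Xi_ex_dual_cone[OF x, of "-2" 0 6]
    then show ?thesis
      unfolding system_ex_iff y_def by (simp add: max_def)
  qed
  then show ?thesis
    unfolding globally_feasible_def by blast
qed

text \<open>
  With zero right-hand side, a recourse that is forced to vanish at the vertex \<open>0\<close> has no constant
  term. Shrinking \<open>\<xi>\<close> towards \<open>0\<close> keeps it in a convex set, and a linear inequality that holds at
  \<open>t \<xi>\<close> holds at \<open>\<xi>\<close>, so the restriction to a ball disappears.
\<close>

lemma locally_linear_feasible_homogeneous:
  fixes W :: "real ^ 'r ^ 'm" and H :: "real ^ 'd ^ 'm"
  assumes "locally_linear_feasible W H 0 X 0"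
    and X: "convex X" "0 \<in> X"
    and W: "\<And>y. W *v y \<ge> 0 \<Longrightarrow> y = 0"
  shows "\<exists>Y :: real ^ 'd ^ 'r. \<forall>\<xi>\<in>X. W *v (Y *v \<xi>) + H *v \<xi> \<ge> 0"
proof -
  obtain e y\<^sub>0 Y where e: "e > 0"
    and *: "\<forall>\<xi>\<in>X \<inter> ball 0 e. W *v (y\<^sub>0 + Y *v \<xi>) + H *v \<xi> \<ge> 0"
    using assms(1) unfolding locally_linear_feasible_def by blast
  have "W *v y\<^sub>0 \<ge> 0"
    using bspec[OF *, of 0] X e by simp
  then have y\<^sub>0: "y\<^sub>0 = 0"
    by (rule W)
  have "W *v (Y *v \<xi>) + H *v \<xi> \<ge> 0" if \<xi>: "\<xi> \<in> X" for \<xi>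
  proof -
    define t where "t = min 1 (e / (norm \<xi> + 1))"
    have pos: "norm \<xi> + 1 > 0"
      using norm_ge_zero[of \<xi>] by linarith
    have t: "0 < t" "t \<le> 1"
      using e pos by (simp_all add: t_def)
    have "t * (norm \<xi> + 1) \<le> e"
      using pos by (simp add: t_def flip: pos_le_divide_eq)
    then have "norm (t *\<^sub>R \<xi>) < e"
      using t by (simp add: algebra_simps)
    moreover have "t *\<^sub>R \<xi> \<in> X"
      using convexD_alt[OF X \<xi>, of t] t by simp
    ultimately have "W *v (Y *v (t *\<^sub>R \<xi>)) + H *v (t *\<^sub>R \<xi>) \<ge> 0"
      using * y\<^sub>0 by simp
    then have "t *\<^sub>R (W *v (Y *v \<xi>) + H *v \<xi>) \<ge> 0"
      by (simp add: matrix_vector_mult_scaleR scaleR_add_right)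
    then show ?thesis
      using t(1) by (simp add: less_eq_vec_def zero_le_mult_iff)
  qed
  then show ?thesis
    by blast
qed

text \<open>
  Writing \<open>x = cos (\<pi>/7)\<close>, the triple-angle formula turns \<open>sin (4\<pi>/7) = sin (3\<pi>/7)\<close> into
  \<open>sin (\<pi>/7) (4 x\<^sup>2 - 1)\<close>. After division by \<open>sin (6\<pi>/7) = sin (\<pi>/7)\<close> the left-hand side is
  \<open>6 - 8 sin (4\<pi>/7) + 3 (4 x\<^sup>2 - 1) (1 - x)\<close>, about \<open>-1.13\<close>. Since
  \<open>sin (4\<pi>/7) = cos (\<pi>/14) = sqrt ((1 + x) / 2)\<close>, the crude bounds \<open>cos (\<pi>/6) \<le> x \<le> 1\<close> already
  determine the sign.
\<close>

lemma heptagon_certificate_negative: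
  "sin (6 * pi / 7) * (6 - 4 * sin (4 * pi / 7))
   + sin (4 * pi / 7) * (3 + 3 * cos (6 * pi / 7) - 4 * sin (6 * pi / 7)) < 0"
proof -
  define x s r where "x = cos (pi / 7)" and "s = sin (pi / 7)" and "r = sin (4 * pi / 7)"
  have s6: "sin (6 * pi / 7) = s"
    using sin_pi_minus[of "pi / 7"] by (simp add: s_def field_simps)
  have c6: "cos (6 * pi / 7) = - x"
    using cos_pi_minus[of "pi / 7"] by (simp add: x_def field_simps)
  have s: "s > 0"
    unfolding s_def by (rule sin_gt_zero) simp_all
  have "cos (pi / 6) \<le> x"
    unfolding x_def by (rule cos_monotone_0_pi_le) simp_all
  moreover have "433 / 250 \<le> sqrt 3"
    by (rule real_le_rsqrt) (simp add: power2_eq_square)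
  ultimately have x: "433 / 500 \<le> x"
    by (simp add: cos_30)
  have x1: "x \<le> 1"
    by (simp add: x_def)
  have pythagoras: "s\<^sup>2 + x\<^sup>2 = 1"
    by (simp add: s_def x_def)
  have "r = sin (2 * (pi / 7) + pi / 7)"
    using sin_pi_minus[of "4 * pi / 7"] by (simp add: r_def field_simps)
  also have "\<dots> = 2 * s * x * x + (x\<^sup>2 - s\<^sup>2) * s"
    unfolding sin_add sin_double cos_double s_def x_def ..
  finally have r: "r = s * (4 * x\<^sup>2 - 1)"
    using pythagoras by algebra
  have r_cos: "r = cos (pi / 14)"
    using sin_cos_eq[of "4 * pi / 7"] cos_minus[of "pi / 14"] by (simp add: r_def field_simps)
  have "r\<^sup>2 = (1 + x) / 2"
    using cos_double_cos[of "pi / 14"] by (simp add: r_cos x_def)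
  then have "(19 / 20)\<^sup>2 \<le> r\<^sup>2"
    using x by (simp add: power2_eq_square)
  moreover have "0 \<le> r"
    unfolding r_cos by (rule cos_ge_zero) simp_all
  ultimately have r_ge: "19 / 20 \<le> r"
    by (rule power2_le_imp_le)
  define q where "q = (4 * x\<^sup>2 - 1) * (1 - x)"
  have "x\<^sup>2 \<le> 1"
    using x x1 by (simp add: power_le_one)
  then have "q \<le> 3 * (1 - x)"
    unfolding q_def using x1 by (intro mult_right_mono) auto
  then have "6 - 8 * r + 3 * q < 0"
    using x r_ge by (simp add: field_simps)
  then have "s * (6 - 8 * r + 3 * q) < 0"
    using s by (simp add: mult_pos_neg)
  also have "s * (6 - 8 * r + 3 * q)
      = s * (6 - 4 * r) + r * (3 - 3 * x - 4 * s)"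
    using r q_def by algebra
  finally show ?thesis
    by (simp add: s6 c6 flip: r_def)
qed

lemma p_ex_trapezoid:
  "p_ex 3 = vector [cos (4 * pi / 7), sin (4 * pi / 7), 1]"
  "p_ex 4 = vector [cos (6 * pi / 7), sin (6 * pi / 7), 1]"
  "p_ex 5 = vector [cos (6 * pi / 7), - sin (6 * pi / 7), 1]"
  "p_ex 6 = vector [cos (4 * pi / 7), - sin (4 * pi / 7), 1]"
proof -
  have theta: "theta_ex 3 = 4 * pi / 7" "theta_ex 4 = 6 * pi / 7"
    "theta_ex 5 = 2 * pi - 6 * pi / 7" "theta_ex 6 = 2 * pi - 4 * pi / 7"
    by (simp_all add: theta_ex_def)
  show "p_ex 3 = vector [cos (4 * pi / 7), sin (4 * pi / 7), 1]"
    "p_ex 4 = vector [cos (6 * pi / 7), sin (6 * pi / 7), 1]"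
    "p_ex 5 = vector [cos (6 * pi / 7), - sin (6 * pi / 7), 1]"
    "p_ex 6 = vector [cos (4 * pi / 7), - sin (4 * pi / 7), 1]"
    by (simp_all only: p_ex_def theta cos_2pi_minus sin_2pi_minus)
qed

lemma no_linear_recourse_ex:
  fixes Y :: "real ^ 3 ^ 1"
  assumes "\<forall>\<xi>\<in>Xi_ex. W_ex *v (Y *v \<xi>) + H_ex *v \<xi> \<ge> b_ex"
  shows False
proof -
  define f where "f x = (Y *v x) $ 1" for x
  define c\<^sub>2 s\<^sub>2 c\<^sub>3 s\<^sub>3 where "c\<^sub>2 = cos (4 * pi / 7)" and "s\<^sub>2 = sin (4 * pi / 7)"
    and "c\<^sub>3 = cos (6 * pi / 7)" and "s\<^sub>3 = sin (6 * pi / 7)"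
  note p = p_ex_trapezoid[folded c\<^sub>2_def s\<^sub>2_def c\<^sub>3_def s\<^sub>3_def]
  have *: "W_ex *v (Y *v p_ex j) + H_ex *v p_ex j \<ge> b_ex" if "j \<in> {1..7}" for j
    using assms p_ex_in_Xi_ex that by blast
  have f3: "- (c\<^sub>2 - 2 * s\<^sub>2 + 3) \<le> f (p_ex 3)"
    using *[of 3] unfolding system_ex_iff f_def by (simp add: p)
  have f4: "f (p_ex 4) \<le> 2 * c\<^sub>3 - 2 * s\<^sub>3 + 2"
    using *[of 4] unfolding system_ex_iff f_def by (simp add: p)
  have f5: "- (c\<^sub>3 - 2 * s\<^sub>3 + 1) \<le> f (p_ex 5)"
    using *[of 5] unfolding system_ex_iff f_def by (simp add: p)
  have f6: "f (p_ex 6) \<le> - c\<^sub>2 - 2 * s\<^sub>2 + 3"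
    using *[of 6] unfolding system_ex_iff f_def by (simp add: p)
  have parallel: "s\<^sub>3 * (f (p_ex 3) - f (p_ex 6)) = s\<^sub>2 * (f (p_ex 4) - f (p_ex 5))"
    by (simp add: f_def p matrix_vector_mult_def sum_3 algebra_simps)
  have "0 < s\<^sub>2" "0 < s\<^sub>3"
    unfolding s\<^sub>2_def s\<^sub>3_def by (rule sin_gt_zero; simp)+
  then have "s\<^sub>3 * (4 * s\<^sub>2 - 6) \<le> s\<^sub>3 * (f (p_ex 3) - f (p_ex 6))"
    and "s\<^sub>2 * (f (p_ex 4) - f (p_ex 5)) \<le> s\<^sub>2 * (3 + 3 * c\<^sub>3 - 4 * s\<^sub>3)"
    using f3 f4 f5 f6 by (simp_all add: mult_left_mono)
  then have "0 \<le> s\<^sub>3 * (6 - 4 * s\<^sub>2) + s\<^sub>2 * (3 + 3 * c\<^sub>3 - 4 * s\<^sub>3)"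
    unfolding parallel by (simp add: algebra_simps)
  then show False
    using heptagon_certificate_negative by (simp add: c\<^sub>3_def s\<^sub>2_def s\<^sub>3_def)
qed

lemma not_locally_linear_feasible_ex: "\<not> locally_linear_feasible W_ex H_ex b_ex Xi_ex 0"
proof
  assume local: "locally_linear_feasible W_ex H_ex b_ex Xi_ex 0"
  have b: "b_ex = 0"
    by (simp add: vec_eq_iff forall_4 b_ex_def)
  have "y = 0" if "W_ex *v y \<ge> 0" for y
    using that system_ex_iff[of y 0] by (simp add: b vec_eq_iff)
  then obtain Y :: "real ^ 3 ^ 1" where "\<forall>\<xi>\<in>Xi_ex. W_ex *v (Y *v \<xi>) + H_ex *v \<xi> \<ge> b_ex"
    using locally_linear_feasible_homogeneous[of W_ex H_ex Xi_ex] local convex_Xi_ex zero_in_Xi_ex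
    unfolding b by blast
  then show False
    by (rule no_linear_recourse_ex)
qed

theorem theorem3:
  shows "(0 :: real ^ 3) extreme_point_of Xi_ex
    \<and> globally_feasible W_ex H_ex b_ex Xi_ex
    \<and> \<not> locally_linear_feasible W_ex H_ex b_ex Xi_ex 0"
  using zero_extreme_point_of_Xi_ex globally_feasible_ex not_locally_linear_feasible_ex by blast

end
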